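(* Let $n$ be an integer with $1<n<\omega$ and let $(X,\mathcal{T})$ be an $\omega$-resolvable topological space. Then there is an expansion $\mathcal{U}$ of $\mathcal{T}$ such that $(X,\mathcal{U})$ is exactly $n$-resolvable. If in addition $(X,\mathcal{T})\in\mathbb{P}$ with $\mathbb{P}$ a CC$\oplus$ property, then $\mathcal{U}$ may be chosen so that $(X,\mathcal{U})\in\mathbb{P}$.
   Context: No separation axioms are assumed of topological spaces. For a (possibly finite) cardinal $\kappa>1$, a space is $\kappa$-resolvable if there is a family of $\kappa$-many pairwise disjoint nonempty subsets, each dense in the space. For finite $n>1$, a space is exactly $n$-resolvable if it is $n$-resolvable but not $(n+1)$-resolvable. An expansion of a topology $\mathcal{T}$ on a set $X$ is a topology $\mathcal{U}$ on $X$ with $\mathcal{U}\supseteq\mathcal{T}$. For a family $\mathcal{A}$ of subsets of $X$, $\langle\mathcal{A}\rangle$ denotes the smallest topology on $X$ containing $\mathcal{A}$. A topological property $\mathbb{P}$ (a class of topological spaces closed under homeomorphism; we write $(X,\mathcal{T})\in\mathbb{P}$ when the space has $\mathbb{P}$) is a CC$\oplus$ property if it is: (a) chain-closed: for each set $X$ and each nonempty chain (under inclusion) $\mathcal{C}$ of topologies on $X$ with $(X,\mathcal{S})\in\mathbb{P}$ for all $\mathcal{S}\in\mathcal{C}$, the space $X$ with the topology $\langle\bigcup\mathcal{C}\rangle$ is in $\mathbb{P}$; (b) clopen-closed: if $(X,\mathcal{T})\in\mathbb{P}$, $A\subseteq X$ and $\mathcal{U}=\langle\mathcal{T}\cup\{A,X\setminus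 A\}\rangle$, then $(X,\mathcal{U})\in\mathbb{P}$; and (c) $\oplus$-closed: if $(X_0,\mathcal{T}_0)\in\mathbb{P}$, $(X_1,\mathcal{T}_1)\in\mathbb{P}$ and $X_0\cap X_1=\emptyset$, then the topological sum (disjoint union) $(X_0,\mathcal{T}_0)\oplus(X_1,\mathcal{T}_1)$ is in $\mathbb{P}$. *)

theory Defs
  imports "HOL-Analysis.Analysis" "HOL-Library.Equipollence"
begin

text \<open>
  A cardinal \<open>\<kappa>\<close> is given by a set \<open>K\<close> of that cardinality, so \<open>resolvable {..<n}\<close> is
  \<open>n\<close>-resolvability and \<open>resolvable (UNIV :: nat set)\<close> is \<open>\<omega>\<close>-resolvability.
  The notion is only meant for \<open>\<kappa> > 1\<close>.
\<close>

definition resolvable :: "'k set \<Rightarrow> 'a topology \<Rightarrow> bool" where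
  "resolvable K X \<longleftrightarrow>
     (\<exists>\<D>. \<D> \<approx> K \<and> pairwise disjnt \<D> \<and>
        (\<forall>D\<in>\<D>. D \<noteq> {} \<and> D \<subseteq> topspace X \<and> X closure_of D = topspace X))"

definition exactly_resolvable :: "nat \<Rightarrow> 'a topology \<Rightarrow> bool" where
  "exactly_resolvable n X \<longleftrightarrow> resolvable {..<n} X \<and> \<not> resolvable {..<n + 1} X"

definition expansion :: "'a topology \<Rightarrow> 'a topology \<Rightarrow> bool" where
  "expansion \<U> \<T> \<longleftrightarrow>
     topspace \<U> = topspace \<T> \<and> {S. openin \<T> S} \<subseteq> {S. openin \<U> S}"

text \<open>
  The topological sum of two spaces whose point sets are disjoint subsets of one type, carried by
  the union of the point sets (the library's \<^const>\<open>sum_topology\<close> lives on a tagged product type).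
\<close>

definition disjoint_sum :: "'a topology \<Rightarrow> 'a topology \<Rightarrow> 'a topology" where
  "disjoint_sum X Y =
     topology (\<lambda>U. U \<subseteq> topspace X \<union> topspace Y \<and>
                   openin X (U \<inter> topspace X) \<and> openin Y (U \<inter> topspace Y))"

lemma openin_disjoint_sum:
  "openin (disjoint_sum X Y) U \<longleftrightarrow>
     U \<subseteq> topspace X \<union> topspace Y \<and>
     openin X (U \<inter> topspace X) \<and> openin Y (U \<inter> topspace Y)"
proof -
  have "istopology (\<lambda>U. U \<subseteq> topspace X \<union> topspace Y \<and>
          openin X (U \<inter> topspace X) \<and> openin Y (U \<inter> topspace Y))"
    unfolding istopology_def
  proof (rule conjI; intro allI impI)
    fix S T
    assume S: "S \<subseteq> topspace X \<union> topspace Y \<and>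
          openin X (S \<inter> topspace X) \<and> openin Y (S \<inter> topspace Y)"
      and T: "T \<subseteq> topspace X \<union> topspace Y \<and>
          openin X (T \<inter> topspace X) \<and> openin Y (T \<inter> topspace Y)"
    have eq: "S \<inter> T \<inter> A = (S \<inter> A) \<inter> (T \<inter> A)" for A by blast
    have "openin X (S \<inter> T \<inter> topspace X)" "openin Y (S \<inter> T \<inter> topspace Y)"
      unfolding eq[of "topspace X"] eq[of "topspace Y"] by (rule openin_Int; use S T in simp)+
    with S show "S \<inter> T \<subseteq> topspace X \<union> topspace Y \<and>
          openin X (S \<inter> T \<inter> topspace X) \<and> openin Y (S \<inter> T \<inter> topspace Y)"
      by blast
  next
    fix \<K>
    assume K: "\<forall>K\<in>\<K>. K \<subseteq> topspace X \<union> topspace Y \<and>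
          openin X (K \<inter> topspace X) \<and> openin Y (K \<inter> topspace Y)"
    have eq: "\<Union>\<K> \<inter> A = (\<Union>K\<in>\<K>. K \<inter> A)" for A by blast
    have "openin X (\<Union>\<K> \<inter> topspace X)" "openin Y (\<Union>\<K> \<inter> topspace Y)"
      unfolding eq[of "topspace X"] eq[of "topspace Y"] by (rule openin_Union; use K in fast)+
    moreover have "\<Union>\<K> \<subseteq> topspace X \<union> topspace Y"
      using K by blast
    ultimately show "\<Union>\<K> \<subseteq> topspace X \<union> topspace Y \<and>
          openin X (\<Union>\<K> \<inter> topspace X) \<and> openin Y (\<Union>\<K> \<inter> topspace Y)"
      by blast
  qed
  then show ?thesis
    by (simp add: disjoint_sum_def topology_inverse')
qed

lemma topspace_disjoint_sum:
  assumes "topspace X \<inter> topspace Y = {}"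
  shows "topspace (disjoint_sum X Y) = topspace X \<union> topspace Y"
proof
  show "topspace (disjoint_sum X Y) \<subseteq> topspace X \<union> topspace Y"
    by (rule conjunct1[OF iffD1[OF openin_disjoint_sum openin_topspace]])
  have "(topspace X \<union> topspace Y) \<inter> topspace X = topspace X"
    "(topspace X \<union> topspace Y) \<inter> topspace Y = topspace Y" by fast+
  then have "openin (disjoint_sum X Y) (topspace X \<union> topspace Y)"
    by (simp add: openin_disjoint_sum)
  then show "topspace X \<union> topspace Y \<subseteq> topspace (disjoint_sum X Y)"
    by (rule openin_subset)
qed

text \<open>
  A topological property is a homeomorphism-invariant predicate on the spaces whose points come
  from the type \<^typ>\<open>'a\<close>; the sets \<open>X\<close> below are subsets of that type.
  An \<open>\<omega>\<close>-resolvable space is infinite, so a type containing one has room for homeomorphic copies of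
  binary sums, and restricting to one type loses no generality. In all uses of
  \<open>topology_generated_by\<close> the generating family has union \<open>X\<close>, so the generated topology is
  the smallest topology on \<open>X\<close> containing the family.
\<close>

definition topological_property :: "('a topology \<Rightarrow> bool) \<Rightarrow> bool" where
  "topological_property P \<longleftrightarrow> (\<forall>X Y. X homeomorphic_space Y \<and> P X \<longrightarrow> P Y)"

definition chain_closed :: "('a topology \<Rightarrow> bool) \<Rightarrow> bool" where
  "chain_closed P \<longleftrightarrow>
     (\<forall>X \<C>. \<C> \<noteq> {} \<and> (\<forall>\<S>\<in>\<C>. topspace \<S> = X \<and> P \<S>) \<and>
        (\<forall>\<S>\<in>\<C>. \<forall>\<S>'\<in>\<C>. expansion \<S> \<S>' \<or> expansion \<S>' \<S>) \<longrightarrow>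
        P (topology_generated_by (\<Union>\<S>\<in>\<C>. {U. openin \<S> U})))"

definition clopen_closed :: "('a topology \<Rightarrow> bool) \<Rightarrow> bool" where
  "clopen_closed P \<longleftrightarrow>
     (\<forall>\<T> A. P \<T> \<and> A \<subseteq> topspace \<T> \<longrightarrow>
        P (topology_generated_by ({U. openin \<T> U} \<union> {A, topspace \<T> - A})))"

definition sum_closed :: "('a topology \<Rightarrow> bool) \<Rightarrow> bool" where
  "sum_closed P \<longleftrightarrow>
     (\<forall>X Y. P X \<and> P Y \<and> topspace X \<inter> topspace Y = {} \<longrightarrow> P (disjoint_sum X Y))"

definition CC_sum_property :: "('a topology \<Rightarrow> bool) \<Rightarrow> bool" where
  "CC_sum_property P \<longleftrightarrow>
     topological_property P \<and> chain_closed P \<and> clopen_closed P \<and> sum_closed P"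

end

theory Submission
  imports Defs "HOL-Library.Nat_Bijection"
begin

text \<open>
  Call a family \<open>\<A>\<close> of subsets of \<open>X\<close> independent if every Boolean cell formed from finitely many
  members of \<open>\<A>\<close> is dense in \<open>\<T>\<close>. An \<open>\<omega>\<close>-resolvable space has an infinite independent family,
  hence an infinite maximal one \<open>\<A>\<close>. Maximality forces some nonempty \<open>V \<inter> C\<close>, with \<open>V\<close> open and \<open>C\<close>
  a cell, to be hereditarily irresolvable in the topology obtained from \<open>\<T>\<close> by making all members of
  \<open>\<A>\<close> clopen: otherwise sets splitting disjoint pieces could be glued to a set extending \<open>\<A>\<close>.
  Independent families are homogeneous: cut \<open>C\<close> into cells by finitely many further members of \<open>\<A>\<close>
  and keep as clopen sets only the members of \<open>\<A>\<close> not used so far. Then every such cell stays dense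
  and is still hereditarily irresolvable on \<open>V\<close>. Declaring the union of \<open>n\<close> of these cells clopen
  therefore gives a space that is exactly \<open>n\<close>-resolvable on that union, while the remaining cells
  keep the complement \<open>n\<close>-resolvable.
\<close>

section \<open>Making sets clopen\<close>

definition clopen_expansion :: "'a topology \<Rightarrow> 'a set set \<Rightarrow> 'a topology" where
  "clopen_expansion T \<R> =
     topology_generated_by ({U. openin T U} \<union> \<R> \<union> (\<lambda>A. topspace T - A) ` \<R>)"

text \<open>For empty \<open>F\<close> the intersection is \<open>UNIV\<close>, so a cell may leave
  the space; cells are therefore always cut down by an open set.\<close>

definition cell :: "'a set set \<Rightarrow> 'a set set \<Rightarrow> 'a set" where
  "cell F G = \<Inter>F - \<Union>G"

text \<open>The nonempty members of a base of \<open>clopen_expansion T \<R>\<close>, for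
  \<open>\<R>\<close> a family of subsets of the space. Nonemptiness already forces \<open>F\<close>
  and \<open>G\<close> to be disjoint.\<close>

definition basic :: "'a topology \<Rightarrow> 'a set set \<Rightarrow> 'a set \<Rightarrow> bool" where
  "basic T \<R> B \<longleftrightarrow> B \<noteq> {} \<and>
     (\<exists>V F G. openin T V \<and> finite F \<and> finite G \<and> F \<subseteq> \<R> \<and> G \<subseteq> \<R> \<and> B = V \<inter> cell F G)"

lemma cell_Un: "cell (F \<union> F') (G \<union> G') = cell F G \<inter> cell F' G'"
  by (auto simp: cell_def)

lemma cell_antimono: "F \<subseteq> F' \<Longrightarrow> G \<subseteq> G' \<Longrightarrow> cell F' G' \<subseteq> cell F G"
  by (auto simp: cell_def)

lemma cell_empty [simp]: "cell {} {} = UNIV"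
  by (simp add: cell_def)

lemma basic_nonempty: "basic T \<R> B \<Longrightarrow> B \<noteq> {}"
  by (simp add: basic_def)

lemma basic_subset_topspace: "basic T \<R> B \<Longrightarrow> B \<subseteq> topspace T"
  using openin_subset by (fastforce simp: basic_def)

lemma basicI:
  assumes "openin T V" "finite F" "finite G" "F \<subseteq> \<R>" "G \<subseteq> \<R>" "V \<inter> cell F G \<noteq> {}"
  shows "basic T \<R> (V \<inter> cell F G)"
  using assms unfolding basic_def by blast

lemma basicE:
  assumes "basic T \<R> B"
  obtains V F G where "openin T V" "finite F" "finite G" "F \<subseteq> \<R>" "G \<subseteq> \<R>" "B = V \<inter> cell F G"
  using assms unfolding basic_def by blast

lemma basic_open: "openin T V \<Longrightarrow> V \<noteq> {} \<Longrightarrow> basic T \<R> V"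
  using basicI[of T V "{}" "{}" \<R>] by simp

lemma basic_mono: "basic T \<R> B \<Longrightarrow> \<R> \<subseteq> \<R>' \<Longrightarrow> basic T \<R>' B"
  unfolding basic_def by blast

lemma basic_Int:
  assumes "basic T \<R> A" "basic T \<R> B" "A \<inter> B \<noteq> {}"
  shows "basic T \<R> (A \<inter> B)"
proof -
  obtain V F G where A: "openin T V" "finite F" "finite G" "F \<subseteq> \<R>" "G \<subseteq> \<R>" "A = V \<inter> cell F G"
    using assms(1) by (rule basicE)
  obtain V' F' G' where
    B: "openin T V'" "finite F'" "finite G'" "F' \<subseteq> \<R>" "G' \<subseteq> \<R>" "B = V' \<inter> cell F' G'"
    using assms(2) by (rule basicE)
  have "A \<inter> B = (V \<inter> V') \<inter> cell (F \<union> F') (G \<union> G')"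
    unfolding cell_Un A B by blast
  then show ?thesis
    using A B assms(3) basicI[of T "V \<inter> V'" "F \<union> F'" "G \<union> G'" \<R>] by auto
qed

lemma openin_topology_generated_by_least:
  assumes "openin (topology_generated_by \<S>) U" "\<And>S. S \<in> \<S> \<Longrightarrow> openin X S"
  shows "openin X U"
  by (rule generate_topology_on_coarsest[OF _ _ openin_topology_generated_by[OF assms(1)]])
    (auto simp: assms(2))

lemma topology_generated_by_eqI:
  assumes "\<And>S. S \<in> \<S> \<Longrightarrow> openin (topology_generated_by \<S>') S"
    and "\<And>S. S \<in> \<S>' \<Longrightarrow> openin (topology_generated_by \<S>) S"
  shows "topology_generated_by \<S> = topology_generated_by \<S>'"
  unfolding topology_eq by (blast intro: openin_topology_generated_by_least assms)

lemma topspace_clopen_expansion: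
  assumes "\<R> \<subseteq> Pow (topspace T)"
  shows "topspace (clopen_expansion T \<R>) = topspace T"
proof -
  have "openin T U \<Longrightarrow> U \<subseteq> topspace T" for U
    by (rule openin_subset)
  then show ?thesis
    using assms unfolding clopen_expansion_def topology_generated_by_topspace by blast
qed

lemma openin_clopen_expansion:
  "openin T U \<Longrightarrow> openin (clopen_expansion T \<R>) U"
  "A \<in> \<R> \<Longrightarrow> openin (clopen_expansion T \<R>) A"
  "A \<in> \<R> \<Longrightarrow> openin (clopen_expansion T \<R>) (topspace T - A)"
  unfolding clopen_expansion_def by (rule topology_generated_by_Basis; blast)+

lemma expansion_clopen_expansion:
  "\<R> \<subseteq> Pow (topspace T) \<Longrightarrow> expansion (clopen_expansion T \<R>) T"
  by (auto simp: expansion_def topspace_clopen_expansion openin_clopen_expansion)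

lemma clopen_expansion_mono:
  assumes "\<R> \<subseteq> \<R>'" "openin (clopen_expansion T \<R>) U"
  shows "openin (clopen_expansion T \<R>') U"
  using assms(2) unfolding clopen_expansion_def[of T \<R>]
  by (rule openin_topology_generated_by_least)
    (use assms(1) in \<open>auto intro: openin_clopen_expansion\<close>)

lemma openin_basic:
  assumes "basic T \<R> B"
  shows "openin (clopen_expansion T \<R>) B"
proof -
  obtain V F G where *: "openin T V" "finite F" "finite G" "F \<subseteq> \<R>" "G \<subseteq> \<R>" "B = V \<inter> cell F G"
    using assms by (rule basicE)
  let ?U = "clopen_expansion T \<R>"
  have "openin ?U (\<Inter>(insert V (F \<union> (\<lambda>A. topspace T - A) ` G)))"
    by (rule openin_Inter) (use * in \<open>auto intro: openin_clopen_expansion\<close>)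
  also have "\<Inter>(insert V (F \<union> (\<lambda>A. topspace T - A) ` G)) = B"
    using openin_subset[OF *(1)] by (auto simp: *(6) cell_def)
  finally show ?thesis .
qed

text \<open>Induction on the generation of the topology: each generator is an open set met with a
  cell of at most one condition, and \<open>basic_Int\<close> handles intersections.\<close>

lemma open_contains_basic:
  assumes "\<R> \<subseteq> Pow (topspace T)" "openin (clopen_expansion T \<R>) U" "x \<in> U"
  shows "\<exists>B. basic T \<R> B \<and> x \<in> B \<and> B \<subseteq> U"
  using openin_topology_generated_by[OF assms(2)[unfolded clopen_expansion_def]] assms(3)
proof (induction arbitrary: x)
  case Empty
  then show ?case by simp
next
  case (Int a b)
  then obtain A B where "basic T \<R> A" "x \<in> A" "A \<subseteq> a" "basic T \<R> B" "x \<in> B" "B \<subseteq> b"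
    by blast
  then show ?case
    by (intro exI[of _ "A \<inter> B"]) (auto intro: basic_Int)
next
  case (UN K)
  then show ?case by blast
next
  case (Basis s)
  then consider "openin T s" | "s \<in> \<R>" | A where "A \<in> \<R>" "s = topspace T - A"
    by blast
  then show ?case
  proof cases
    case 1
    then show ?thesis
      using Basis.prems basic_open by fastforce
  next
    case 2
    then have "s = topspace T \<inter> cell {s} {}"
      using assms(1) by (auto simp: cell_def)
    then show ?thesis
      using basicI[of T "topspace T" "{s}" "{}" \<R>] 2 Basis.prems by fastforce
  next
    case 3
    then have "s = topspace T \<inter> cell {} {A}"
      by (auto simp: cell_def)
    then show ?thesis
      using basicI[of T "topspace T" "{}" "{A}" \<R>] 3 Basis.prems by fastforce
  qed
qed

text \<open>Adding one set is a step of exactly the shape treated by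
  \<open>clopen_closed\<close>.\<close>

lemma clopen_expansion_insert:
  assumes "\<R> \<subseteq> Pow (topspace T)" "A \<subseteq> topspace T"
  shows "clopen_expansion T (insert A \<R>) =
    topology_generated_by ({U. openin (clopen_expansion T \<R>) U} \<union>
      {A, topspace (clopen_expansion T \<R>) - A})"
  unfolding topspace_clopen_expansion[OF assms(1)]
    clopen_expansion_def[of T "insert A \<R>"]
proof (rule topology_generated_by_eqI, goal_cases)
  case (1 S)
  then have "openin (clopen_expansion T \<R>) S \<or> S \<in> {A, topspace T - A}"
    by (auto intro: openin_clopen_expansion)
  then show ?case
    by (intro topology_generated_by_Basis) blast
next
  case (2 S)
  then show ?case
    unfolding clopen_expansion_def[symmetric, of T "insert A \<R>"]
    by (auto intro: openin_clopen_expansion clopen_expansion_mono[OF subset_insertI])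
qed

text \<open>The limit counterpart: a union of families gives a topology of the shape treated by
  \<open>chain_closed\<close>.\<close>

lemma clopen_expansion_Union:
  assumes "\<C> \<noteq> {}"
  shows "clopen_expansion T (\<Union>\<C>) =
    topology_generated_by (\<Union>\<S>\<in>clopen_expansion T ` \<C>. {U. openin \<S> U})"
  unfolding clopen_expansion_def[of T "\<Union>\<C>"]
proof (rule topology_generated_by_eqI, goal_cases)
  case (1 S)
  then have "\<exists>\<R>\<in>\<C>. openin (clopen_expansion T \<R>) S"
    using assms by (auto intro: openin_clopen_expansion)
  then show ?case
    by (intro topology_generated_by_Basis) blast
next
  case (2 S)
  then show ?case
    unfolding clopen_expansion_def[symmetric, of T "\<Union>\<C>"]
    by (auto intro: clopen_expansion_mono[OF Union_upper])
qed

text \<open>Zorn's lemma replaces a transfinite construction adding the members of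
  \<open>\<R>\<close> one at a time: chain-closedness handles limits, clopen-closedness
  successors.\<close>

lemma chain_clopen_closed_clopen_expansion:
  assumes P: "chain_closed P" "clopen_closed P" "P T" and \<R>: "\<R> \<subseteq> Pow (topspace T)"
  shows "P (clopen_expansion T \<R>)"
proof -
  let ?A = "{\<S>. \<S> \<subseteq> \<R> \<and> P (clopen_expansion T \<S>)}"
  have "clopen_expansion T {} = T"
    unfolding topology_eq
  proof (intro allI iffI)
    fix S assume "openin (clopen_expansion T {}) S"
    then show "openin T S"
      unfolding clopen_expansion_def by (rule openin_topology_generated_by_least) auto
  qed (rule openin_clopen_expansion)
  then have "{} \<in> ?A" using P by simp
  moreover have "\<Union>\<C> \<in> ?A" if \<C>: "\<C> \<noteq> {}" "subset.chain ?A \<C>" for \<C>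
  proof -
    have sub: "\<S> \<subseteq> Pow (topspace T)" "P (clopen_expansion T \<S>)" if "\<S> \<in> \<C>" for \<S>
      using that \<C>(2) \<R> by (auto simp: subset_chain_def)
    have "expansion (clopen_expansion T \<S>) (clopen_expansion T \<S>') \<or>
          expansion (clopen_expansion T \<S>') (clopen_expansion T \<S>)"
      if "\<S> \<in> \<C>" "\<S>' \<in> \<C>" for \<S> \<S>'
    proof -
      have "\<S> \<subseteq> \<S>' \<or> \<S>' \<subseteq> \<S>"
        using \<C>(2) that by (auto simp: subset_chain_def)
      then show ?thesis
        using clopen_expansion_mono[of _ _ T]
        unfolding expansion_def topspace_clopen_expansion[OF sub(1)[OF that(1)]]
          topspace_clopen_expansion[OF sub(1)[OF that(2)]] by blast
    qed
    then have "P (topology_generated_by (\<Union>\<S>\<in>clopen_expansion T ` \<C>. {U. openin \<S> U}))"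
      using \<C>(1) sub
      by (intro P(1)[unfolded chain_closed_def, rule_format, where X = "topspace T"])
        (auto simp: topspace_clopen_expansion)
    then have "P (clopen_expansion T (\<Union>\<C>))"
      by (simp only: clopen_expansion_Union[OF \<C>(1)])
    then show ?thesis
      using \<C>(2) by (auto simp: subset_chain_def)
  qed
  ultimately have "\<exists>\<M>\<in>?A. \<forall>\<S>\<in>?A. \<M> \<subseteq> \<S> \<longrightarrow> \<S> = \<M>"
    by (intro subset_Zorn_nonempty) blast+
  then obtain \<M> where \<M>: "\<M> \<in> ?A" and max: "\<And>\<S>. \<S> \<in> ?A \<Longrightarrow> \<M> \<subseteq> \<S> \<Longrightarrow> \<S> = \<M>"
    by (elim bexE) simp
  \<comment> \<open>A member of \<open>\<R>\<close> missing from \<open>\<M>\<close> could be made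
    clopen as well, against maximality.\<close>
  have "A \<in> \<M>" if "A \<in> \<R>" for A
  proof -
    have "\<M> \<subseteq> Pow (topspace T)" "A \<subseteq> topspace T"
      using \<M> \<R> that by auto
    moreover from this have "P (clopen_expansion T (insert A \<M>))"
      unfolding clopen_expansion_insert[OF calculation]
      using \<M> by (intro P(2)[unfolded clopen_closed_def, rule_format])
        (auto simp: topspace_clopen_expansion)
    ultimately show ?thesis
      using \<M> that max[of "insert A \<M>"] by blast
  qed
  then have "\<M> = \<R>" using \<M> by blast
  then show ?thesis using \<M> by blast
qed

section \<open>Independent families\<close>

definition independent_family :: "'a topology \<Rightarrow> 'a set set \<Rightarrow> bool" where
  "independent_family T \<A> \<longleftrightarrow> \<A> \<subseteq> Pow (topspace T) \<and>
     (\<forall>V F G. openin T V \<and> V \<noteq> {} \<and> finite F \<and> finite G \<and> F \<subseteq> \<A> \<and> G \<subseteq> \<A> \<and> F \<inter> G = {}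
        \<longrightarrow> V \<inter> cell F G \<noteq> {})"

lemma independent_familyD:
  assumes "independent_family T \<A>" "openin T V" "V \<noteq> {}" "finite F" "finite G"
    "F \<subseteq> \<A>" "G \<subseteq> \<A>" "F \<inter> G = {}"
  shows "V \<inter> cell F G \<noteq> {}"
  using assms unfolding independent_family_def by blast

text \<open>The disjoint dense sets are indexed by codes of finite sets of naturals. Every cell then
  contains one of them, namely the one whose code describes the positive conditions.\<close>

lemma omega_resolvable_imp_infinite_independent_family:
  assumes "resolvable (UNIV :: nat set) T"
  shows "\<exists>\<A>. independent_family T \<A> \<and> infinite \<A>"
proof -
  obtain \<D> where \<D>: "\<D> \<approx> (UNIV :: nat set)" "pairwise disjnt \<D>"
    "\<And>D. D \<in> \<D> \<Longrightarrow> D \<noteq> {} \<and> D \<subseteq> topspace T \<and> T closure_of D = topspace T"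
    using assms unfolding resolvable_def by blast
  obtain D :: "nat \<Rightarrow> 'a set" where D: "bij_betw D UNIV \<D>"
    using eqpoll_sym[OF \<D>(1)] unfolding eqpoll_def by blast
  have Din: "D i \<in> \<D>" for i
    using D by (auto simp: bij_betw_def)
  have disj: "i = j" if "x \<in> D i" "x \<in> D j" for x i j
    using that D \<D>(2) Din unfolding bij_betw_def pairwise_def disjnt_def inj_on_def
    by (metis IntI UNIV_I empty_iff)
  have dense: "D i \<inter> V \<noteq> {}" if "openin T V" "V \<noteq> {}" for i V
    using \<D>(3)[OF Din] that unfolding dense_intersects_open by blast
  \<comment> \<open>Here \<open>i\<close> codes the finite set \<open>set_decode i\<close>, and
    \<open>A k\<close> collects the dense sets whose code contains \<open>k\<close>.\<close>
  define A where "A k = (\<Union>i\<in>{i. k \<in> set_decode i}. D i)" for k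
  have A: "x \<in> A k \<longleftrightarrow> k \<in> set_decode i" if "x \<in> D i" for x i k
    using disj that by (auto simp: A_def)
  have "inj A"
  proof (rule injI, rule ccontr)
    fix k l assume kl: "A k = A l" "k \<noteq> l"
    obtain x where "x \<in> D (set_encode {k})"
      using \<D>(3)[OF Din] by blast
    then have "x \<in> A k" "x \<notin> A l"
      using kl(2) A[of x "set_encode {k}"] set_encode_inverse[of "{k}"] by auto
    with kl(1) show False by simp
  qed
  then have "infinite (range A)"
    by (simp add: range_inj_infinite)
  moreover have "independent_family T (range A)"
    unfolding independent_family_def
  proof (intro conjI allI impI)
    show "range A \<subseteq> Pow (topspace T)"
      using \<D>(3)[OF Din] unfolding A_def by blast
  next
    fix V F G
    assume *: "openin T V \<and> V \<noteq> {} \<and> finite F \<and> finite G \<and> F \<subseteq> range A \<and> G \<subseteq> range A \<and> F \<inter> G = {}"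
    obtain I where I: "finite I" "F = A ` I"
      using * finite_subset_image[of F A UNIV] by auto
    obtain J where J: "G = A ` J"
      using * finite_subset_image[of G A UNIV] by auto
    obtain x where x: "x \<in> D (set_encode I)" "x \<in> V"
      using dense[of V "set_encode I"] * by blast
    have "x \<in> A k \<longleftrightarrow> k \<in> I" for k
      using A[OF x(1), of k] I(1) by simp
    moreover have "I \<inter> J = {}"
      using * I J by blast
    ultimately have "x \<in> cell F G"
      unfolding cell_def I J by blast
    with x show "V \<inter> cell F G \<noteq> {}" by blast
  qed
  ultimately show ?thesis by blast
qed

text \<open>Independence has finite character: each instance involves finitely many members, which
  lie in a single member of a chain.\<close>

lemma independent_family_maximal:
  assumes "independent_family T \<A>"
  obtains \<M> where "independent_family T \<M>" "\<A> \<subseteq> \<M>"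
    "\<forall>\<B>. independent_family T \<B> \<and> \<M> \<subseteq> \<B> \<longrightarrow> \<B> = \<M>"
proof -
  let ?I = "{\<B>. independent_family T \<B> \<and> \<A> \<subseteq> \<B>}"
  have "\<Union>\<C> \<in> ?I" if \<C>: "\<C> \<noteq> {}" "subset.chain ?I \<C>" for \<C>
  proof -
    have ind: "independent_family T \<B>" "\<A> \<subseteq> \<B>" if "\<B> \<in> \<C>" for \<B>
      using \<C>(2) that by (auto simp: subset_chain_def)
    have "V \<inter> cell F G \<noteq> {}"
      if "openin T V" "V \<noteq> {}" "finite F" "finite G" "F \<subseteq> \<Union>\<C>" "G \<subseteq> \<Union>\<C>" "F \<inter> G = {}" for V F G
    proof -
      have "finite (F \<union> G)" "F \<union> G \<subseteq> \<Union>\<C>" using that by auto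
      then obtain \<B> where "\<B> \<in> \<C>" "F \<union> G \<subseteq> \<B>"
        using finite_subset_Union_chain[OF _ _ \<C>] by blast
      then show ?thesis
        using independent_familyD[OF ind(1)] that by auto
    qed
    moreover have "\<Union>\<C> \<subseteq> Pow (topspace T)"
      using ind(1) unfolding independent_family_def by blast
    moreover have "\<A> \<subseteq> \<Union>\<C>" using \<C>(1) ind(2) by blast
    ultimately show ?thesis unfolding independent_family_def by blast
  qed
  moreover have "?I \<noteq> {}" using assms by blast
  ultimately have "\<exists>\<M>\<in>?I. \<forall>\<B>\<in>?I. \<M> \<subseteq> \<B> \<longrightarrow> \<B> = \<M>"
    by (intro subset_Zorn_nonempty)
  then obtain \<M> where \<M>: "\<M> \<in> ?I" and max: "\<forall>\<B>\<in>?I. \<M> \<subseteq> \<B> \<longrightarrow> \<B> = \<M>"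
    by (rule bexE)
  have "\<B> = \<M>" if "independent_family T \<B>" "\<M> \<subseteq> \<B>" for \<B>
    using bspec[OF max, of \<B>] that \<M> order_trans[of \<A> \<M> \<B>] by simp
  with \<M> show thesis by (intro that[of \<M>]) simp_all
qed

lemma maximal_disjoint_subfamily:
  "\<exists>\<D>\<subseteq>\<S>. disjoint \<D> \<and> (\<forall>B\<in>\<S>. B \<noteq> {} \<longrightarrow> (\<exists>D\<in>\<D>. B \<inter> D \<noteq> {}))"
proof -
  let ?A = "{\<D>. \<D> \<subseteq> \<S> \<and> disjoint \<D>}"
  have "\<Union>\<C> \<in> ?A" if "subset.chain ?A \<C>" for \<C>
  proof -
    have "disjoint (\<Union>\<C>)"
      using that by (intro pairwise_chain_Union) (auto simp: subset_chain_def chain_subset_def)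
    then show ?thesis
      using that by (auto simp: subset_chain_def)
  qed
  then have "\<exists>\<D>\<in>?A. \<forall>\<E>\<in>?A. \<D> \<subseteq> \<E> \<longrightarrow> \<E> = \<D>"
    by (rule subset_Zorn')
  then obtain \<D> where \<D>: "\<D> \<in> ?A" and max: "\<And>\<E>. \<E> \<in> ?A \<Longrightarrow> \<D> \<subseteq> \<E> \<Longrightarrow> \<E> = \<D>"
    by (elim bexE) simp
  have "\<exists>D\<in>\<D>. B \<inter> D \<noteq> {}" if "B \<in> \<S>" "B \<noteq> {}" for B
  proof (rule ccontr)
    assume neg: "\<not> (\<exists>D\<in>\<D>. B \<inter> D \<noteq> {})"
    then have "disjoint (insert B \<D>)"
      using \<D> by (auto simp: pairwise_insert disjnt_def)
    then have "B \<in> \<D>"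
      using max[of "insert B \<D>"] \<D> that by blast
    then show False using neg that by blast
  qed
  then show ?thesis using \<D> by blast
qed

text \<open>The conclusion says that no nonempty open subset of \<open>B\<^sub>0\<close> splits into
  two dense sets once \<open>\<A>\<close> is clopen. If this failed for every
  \<open>B\<^sub>0\<close>, local splittings would glue to a set \<open>H\<close> splitting all
  basic sets; \<open>H\<close> would extend \<open>\<A>\<close>, hence belong to it, yet
  \<open>H\<close> does not split itself.\<close>

lemma maximal_independent_family_decides:
  assumes ind: "independent_family T \<A>" and ne: "topspace T \<noteq> {}"
    and max: "\<forall>\<B>. independent_family T \<B> \<and> \<A> \<subseteq> \<B> \<longrightarrow> \<B> = \<A>"
  shows "\<exists>B\<^sub>0. basic T \<A> B\<^sub>0 \<and>
    (\<forall>H B. basic T \<A> B \<and> B \<subseteq> B\<^sub>0 \<longrightarrow> (\<exists>B'. basic T \<A> B' \<and> B' \<subseteq> B \<and> (B' \<subseteq> H \<or> B' \<inter> H = {})))"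
proof (rule ccontr)
  define splits where
    "splits H B \<longleftrightarrow> (\<forall>B'. basic T \<A> B' \<and> B' \<subseteq> B \<longrightarrow> \<not> B' \<subseteq> H \<and> B' \<inter> H \<noteq> {})" for H B
  assume neg: "\<not> ?thesis"
  have ex: "\<exists>B' H. basic T \<A> B' \<and> B' \<subseteq> B \<and> splits H B'" if "basic T \<A> B" for B
  proof -
    from neg that obtain H B' where "basic T \<A> B'" "B' \<subseteq> B"
      "\<not> (\<exists>C. basic T \<A> C \<and> C \<subseteq> B' \<and> (C \<subseteq> H \<or> C \<inter> H = {}))"
      by meson
    then show ?thesis
      unfolding splits_def by (intro exI[of _ B'] exI[of _ H]) simp
  qed
  define \<S> where "\<S> = {B. basic T \<A> B \<and> (\<exists>H. splits H B)}"
  define h where "h B = (SOME H. splits H B)" for B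
  have h: "splits (h B) B" if "B \<in> \<S>" for B
    using that unfolding \<S>_def h_def by (auto intro: someI)
  obtain \<D> where \<D>: "\<D> \<subseteq> \<S>" "disjoint \<D>"
    and meet: "\<forall>B\<in>\<S>. B \<noteq> {} \<longrightarrow> (\<exists>D\<in>\<D>. B \<inter> D \<noteq> {})"
    using maximal_disjoint_subfamily[of \<S>] by (elim exE conjE)
  \<comment> \<open>As the pieces in \<open>\<D>\<close> are disjoint, \<open>H\<close> agrees with
    the chosen \<open>h D\<close> on each piece \<open>D\<close>.\<close>
  define H where "H = (\<Union>D\<in>\<D>. h D \<inter> D)"
  have H_D: "x \<in> H \<longleftrightarrow> x \<in> h D" if "D \<in> \<D>" "x \<in> D" for x D
  proof -
    have "D' = D" if "D' \<in> \<D>" "x \<in> D'" for D'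
      using pairwiseD[OF \<D>(2), of D' D] that \<open>D \<in> \<D>\<close> \<open>x \<in> D\<close> by (auto simp: disjnt_def)
    then show ?thesis
      using that unfolding H_def by blast
  qed
  have split: "B \<inter> H \<noteq> {}" "B - H \<noteq> {}" if B: "basic T \<A> B" for B
  proof -
    obtain B1 where B1: "B1 \<in> \<S>" "B1 \<subseteq> B" "basic T \<A> B1"
      using ex[OF B] unfolding \<S>_def by blast
    \<comment> \<open>By maximality of \<open>\<D>\<close> the set \<open>B1\<close> meets a piece
      \<open>D\<close>, and the basic set \<open>B1 \<inter> D\<close> is split by
      \<open>h D\<close>.\<close>
    obtain D where D: "D \<in> \<D>" "B1 \<inter> D \<noteq> {}"
      using meet B1(1) basic_nonempty[OF B1(3)] by blast
    have "basic T \<A> (B1 \<inter> D)"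
      using D \<D>(1) B1 by (intro basic_Int) (auto simp: \<S>_def)
    then have "\<not> B1 \<inter> D \<subseteq> h D" "B1 \<inter> D \<inter> h D \<noteq> {}"
      using h[of D] D(1) \<D>(1) unfolding splits_def by blast+
    then show "B \<inter> H \<noteq> {}" "B - H \<noteq> {}"
      using B1(2) H_D[OF D(1)] by blast+
  qed
  have H_sub: "H \<subseteq> topspace T"
    using \<D>(1) basic_subset_topspace unfolding H_def \<S>_def by blast
  have "independent_family T (insert H \<A>)"
    unfolding independent_family_def
  proof (intro conjI allI impI)
    show "insert H \<A> \<subseteq> Pow (topspace T)"
      using H_sub ind by (auto simp: independent_family_def)
  next
    fix V F G
    assume *: "openin T V \<and> V \<noteq> {} \<and> finite F \<and> finite G \<and> F \<subseteq> insert H \<A> \<and>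
      G \<subseteq> insert H \<A> \<and> F \<inter> G = {}"
    let ?B = "V \<inter> cell (F - {H}) (G - {H})"
    have "basic T \<A> ?B"
      using * independent_familyD[OF ind, of V "F - {H}" "G - {H}"] by (intro basicI) blast+
    then have "?B \<inter> H \<noteq> {}" "?B - H \<noteq> {}"
      by (rule split)+
    \<comment> \<open>Since \<open>F\<close> and \<open>G\<close> are disjoint, \<open>H\<close>
      occurs in at most one of them, so one half of \<open>?B\<close> satisfies all
      conditions.\<close>
    moreover have "?B \<inter> H \<subseteq> V \<inter> cell F G \<or> ?B - H \<subseteq> V \<inter> cell F G"
      using * by (auto simp: cell_def)
    ultimately show "V \<inter> cell F G \<noteq> {}" by blast
  qed
  then have "H \<in> \<A>"
    using max by blast
  then have "basic T \<A> (topspace T \<inter> cell {H} {})"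
    using ne independent_familyD[OF ind, of "topspace T" "{H}" "{}"] by (intro basicI) simp_all
  from split(2)[OF this] show False
    by (simp add: cell_def)
qed

section \<open>The exactly \<open>n\<close>-resolvable expansion\<close>

lemma exactly_resolvable_clopen_expansion:
  fixes n :: nat
  assumes "1 < n" "resolvable (UNIV :: nat set) T"
  shows "\<exists>\<R>\<subseteq>Pow (topspace T). exactly_resolvable n (clopen_expansion T \<R>)"
proof -

  \<comment> \<open>Choice of the independent family and of the cells\<close>
  obtain \<A>\<^sub>0 where \<A>\<^sub>0: "independent_family T \<A>\<^sub>0" "infinite \<A>\<^sub>0"
    using omega_resolvable_imp_infinite_independent_family[OF assms(2)] by blast
  obtain \<A> where ind: "independent_family T \<A>" and "\<A>\<^sub>0 \<subseteq> \<A>"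
    and max: "\<forall>\<B>. independent_family T \<B> \<and> \<A> \<subseteq> \<B> \<longrightarrow> \<B> = \<A>"
    by (rule independent_family_maximal[OF \<A>\<^sub>0(1)])
  with \<A>\<^sub>0(2) have inf: "infinite \<A>"
    using finite_subset by blast
  have \<A>_sub: "\<A> \<subseteq> Pow (topspace T)"
    using ind by (simp add: independent_family_def)
  have ne: "topspace T \<noteq> {}"
  proof
    assume "topspace T = {}"
    then have "\<A> \<subseteq> {{}}" using \<A>_sub by simp
    then show False using inf finite_subset by blast
  qed
  obtain B\<^sub>0 where B\<^sub>0: "basic T \<A> B\<^sub>0"
    and dec: "\<forall>H B. basic T \<A> B \<and> B \<subseteq> B\<^sub>0 \<longrightarrow>
      (\<exists>B'. basic T \<A> B' \<and> B' \<subseteq> B \<and> (B' \<subseteq> H \<or> B' \<inter> H = {}))"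
    using maximal_independent_family_decides[OF ind ne max] by (elim exE conjE)
  obtain V\<^sub>0 F\<^sub>0 G\<^sub>0 where
    0: "openin T V\<^sub>0" "finite F\<^sub>0" "finite G\<^sub>0" "F\<^sub>0 \<subseteq> \<A>" "G\<^sub>0 \<subseteq> \<A>" "B\<^sub>0 = V\<^sub>0 \<inter> cell F\<^sub>0 G\<^sub>0"
    using B\<^sub>0 by (rule basicE)
  have FG0: "F\<^sub>0 \<inter> G\<^sub>0 = {}"
    using basic_nonempty[OF B\<^sub>0] by (auto simp: 0 cell_def)
  have inf1: "infinite (\<A> - (F\<^sub>0 \<union> G\<^sub>0))"
    using inf 0 by (intro Diff_infinite_finite) auto
  obtain S\<^sub>1 where S1: "S\<^sub>1 \<subseteq> \<A> - (F\<^sub>0 \<union> G\<^sub>0)" "finite S\<^sub>1" "card S\<^sub>1 = n"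
    using infinite_arbitrarily_large[OF inf1, of n] by (elim exE conjE)
  have inf2: "infinite (\<A> - (F\<^sub>0 \<union> G\<^sub>0) - S\<^sub>1)"
    using S1(2) inf1 by (rule Diff_infinite_finite)
  obtain S\<^sub>2 where S2: "S\<^sub>2 \<subseteq> \<A> - (F\<^sub>0 \<union> G\<^sub>0) - S\<^sub>1" "finite S\<^sub>2" "card S\<^sub>2 = n"
    using infinite_arbitrarily_large[OF inf2, of n] by (elim exE conjE)
  define S where "S = S\<^sub>1 \<union> S\<^sub>2"
  \<comment> \<open>Members entering the definition of the cells \<open>E b\<close> are left out, so
    that these cells stay dense after \<open>\<R>\<close> becomes clopen.\<close>
  define \<R> where "\<R> = \<A> - (F\<^sub>0 \<union> G\<^sub>0 \<union> S)"
  \<comment> \<open>Among the members of \<open>S\<close> only \<open>b\<close> is taken positively,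
    which makes the cells disjoint; the conditions \<open>F\<^sub>0\<close> and
    \<open>G\<^sub>0\<close> put \<open>V\<^sub>0 \<inter> E b\<close> inside
    \<open>B\<^sub>0\<close>.\<close>
  define E where "E b = cell (insert b F\<^sub>0) (G\<^sub>0 \<union> (S - {b}))" for b
  define M where "M = (\<Union>b\<in>S\<^sub>1. E b)"
  have S: "finite S" "S \<subseteq> \<A>" "S \<inter> (F\<^sub>0 \<union> G\<^sub>0) = {}" "S\<^sub>1 \<subseteq> S" "S\<^sub>2 \<subseteq> S" "S\<^sub>1 \<inter> S\<^sub>2 = {}"
    using S1 S2 by (auto simp: S_def)
  have E_disj: "E b \<inter> E c = {}" if "b \<in> S" "c \<in> S" "b \<noteq> c" for b c
    using that by (auto simp: E_def cell_def)
  have E_sub: "E b \<subseteq> topspace T" if "b \<in> S" for b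
    using that S(2) \<A>_sub by (auto simp: E_def cell_def)
  have basic_E: "basic T \<A> (B \<inter> E b)" if B: "basic T \<R> B" and b: "b \<in> S" for B b
  proof -
    obtain V F G where *: "openin T V" "finite F" "finite G" "F \<subseteq> \<R>" "G \<subseteq> \<R>" "B = V \<inter> cell F G"
      using B by (rule basicE)
    define F' where "F' = F \<union> insert b F\<^sub>0"
    define G' where "G' = G \<union> (G\<^sub>0 \<union> (S - {b}))"
    have BE: "B \<inter> E b = V \<inter> cell F' G'"
      unfolding F'_def G'_def cell_Un[of F] * E_def by blast
    have fin: "finite F'" "finite G'"
      using * 0 S by (auto simp: F'_def G'_def)
    have sub: "F' \<subseteq> \<A>" "G' \<subseteq> \<A>"
      using * 0 S b unfolding F'_def G'_def \<R>_def by blast+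
    have "V \<noteq> {}" "F \<inter> G = {}"
      using basic_nonempty[OF B] by (auto simp: * cell_def)
    moreover from this have "F' \<inter> G' = {}"
      using *(4,5) S(3) b FG0 unfolding F'_def G'_def \<R>_def by blast
    ultimately show ?thesis
      unfolding BE by (intro basicI * fin sub independent_familyD[OF ind])
  qed
  have shrink: "\<exists>C. basic T \<R> C \<and> C \<subseteq> B \<and> (C \<inter> E b \<subseteq> H \<or> C \<inter> E b \<inter> H = {})"
    if B: "basic T \<R> B" "B \<subseteq> V\<^sub>0" and b: "b \<in> S" for B b H
  proof -
    have "B \<inter> E b \<subseteq> B\<^sub>0"
      using B(2) unfolding 0(6) E_def cell_def by blast
    then obtain B' where B': "basic T \<A> B'" "B' \<subseteq> B \<inter> E b" "B' \<subseteq> H \<or> B' \<inter> H = {}"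
      using dec basic_E[OF B(1) b] by blast
    obtain V F G where *: "openin T V" "finite F" "finite G" "F \<subseteq> \<A>" "G \<subseteq> \<A>" "B' = V \<inter> cell F G"
      using B'(1) by (rule basicE)
    define C where "C = V \<inter> cell (F \<inter> \<R>) (G \<inter> \<R>)"
    have B'C: "B' \<subseteq> C"
      unfolding *(6) C_def cell_def by blast
    have C: "basic T \<R> C"
      unfolding C_def using * B'C[unfolded C_def] basic_nonempty[OF B'(1)]
      by (intro basicI) auto
    have ne': "cell F G \<inter> E b \<noteq> {}"
      using B'(2) basic_nonempty[OF B'(1)] *(6) by blast
    \<comment> \<open>A member of \<open>F\<close> outside \<open>\<R>\<close> lies in
      \<open>F\<^sub>0\<close>, \<open>G\<^sub>0\<close> or \<open>S\<close>; were it in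
      \<open>G\<^sub>0\<close> or \<open>S - {b}\<close>, the cells would be disjoint, contrary to
      \<open>ne'\<close>. The case of \<open>G\<close> is symmetric.\<close>
    have "F \<subseteq> F \<inter> \<R> \<union> insert b F\<^sub>0"
      using ne' *(4) by (auto simp: \<R>_def E_def cell_def)
    moreover have "G \<subseteq> G \<inter> \<R> \<union> (G\<^sub>0 \<union> (S - {b}))"
      using ne' *(5) by (auto simp: \<R>_def E_def cell_def)
    ultimately have "cell (F \<inter> \<R>) (G \<inter> \<R>) \<inter> E b \<subseteq> cell F G"
      unfolding E_def cell_Un[symmetric] by (rule cell_antimono)
    then have "C \<inter> E b \<subseteq> B'"
      unfolding C_def *(6) by blast
    moreover have "basic T \<R> (C \<inter> B)"
      using B'C B'(2) basic_nonempty[OF B'(1)] by (intro basic_Int C B) blast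
    ultimately show ?thesis
      using B'(3) by (intro exI[of _ "C \<inter> B"]) blast
  qed

  \<comment> \<open>The expansion and its \<open>n\<close> disjoint dense sets\<close>
  define U where "U = clopen_expansion T (insert M \<R>)"
  have M_sub: "M \<subseteq> topspace T"
    unfolding M_def using E_sub S(4) by blast
  have MR: "insert M \<R> \<subseteq> Pow (topspace T)"
    using M_sub \<A>_sub by (auto simp: \<R>_def)
  have top_U: "topspace U = topspace T"
    unfolding U_def by (rule topspace_clopen_expansion[OF MR])
  have M_E: "E b \<inter> M = {}" if "b \<in> S\<^sub>2" for b
  proof -
    have "E b \<inter> E c = {}" if "c \<in> S\<^sub>1" for c
      using \<open>b \<in> S\<^sub>2\<close> that S by (intro E_disj) auto
    then show ?thesis unfolding M_def by blast
  qed
  \<comment> \<open>A basic set of \<open>U\<close> is an \<open>\<R>\<close>-basic set possibly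
    restricted to \<open>M\<close> or to its complement. One cell on each side of \<open>M\<close>
    suffices to meet it.\<close>
  have dense: "(E b \<union> E c) \<inter> W \<noteq> {}"
    if W: "openin U W" "W \<noteq> {}" and bc: "b \<in> S\<^sub>1" "c \<in> S\<^sub>2" for W b c
  proof -
    obtain x where "x \<in> W" using W(2) by blast
    then obtain B where B: "basic T (insert M \<R>) B" "B \<subseteq> W"
      using open_contains_basic[OF MR W(1)[unfolded U_def]] by blast
    obtain V F G where *: "openin T V" "finite F" "finite G" "F \<subseteq> insert M \<R>" "G \<subseteq> insert M \<R>"
      "B = V \<inter> cell F G"
      using B(1) by (rule basicE)
    define C where "C = V \<inter> cell (F - {M}) (G - {M})"
    have "B \<subseteq> C"
      unfolding *(6) C_def by (intro Int_mono cell_antimono) auto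
    then have "C \<noteq> {}"
      using basic_nonempty[OF B(1)] by auto
    then have "basic T \<R> C"
      unfolding C_def using * by (intro basicI) auto
    then have "C \<inter> E b \<noteq> {}" "C \<inter> E c \<noteq> {}"
      using bc S(4,5) basic_nonempty[OF basic_E[of C b]] basic_nonempty[OF basic_E[of C c]] by auto
    moreover have "C \<inter> E b \<subseteq> B \<or> C \<inter> E c \<subseteq> B"
    proof (cases "M \<in> G")
      case True
      then have "M \<notin> F"
        using basic_nonempty[OF B(1)] by (auto simp: *(6) cell_def)
      then have "C - M \<subseteq> B"
        by (auto simp: C_def *(6) cell_def)
      then show ?thesis
        using M_E[OF bc(2)] by blast
    next
      case False
      then have "C \<inter> M \<subseteq> B"
        by (auto simp: C_def *(6) cell_def)
      moreover have "E b \<subseteq> M"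
        unfolding M_def using bc(1) by blast
      ultimately show ?thesis by blast
    qed
    ultimately show ?thesis using B(2) by blast
  qed
  obtain f where f: "bij_betw f S\<^sub>1 S\<^sub>2"
    using finite_same_card_bij[OF S1(2) S2(2)] S1(3) S2(3) by auto
  have fS: "f b \<in> S\<^sub>2" if "b \<in> S\<^sub>1" for b
    using f that by (auto simp: bij_betw_def)
  \<comment> \<open>The bijection \<open>f\<close> pairs each cell inside \<open>M\<close> with a
    cell outside, giving \<open>n\<close> disjoint dense sets.\<close>
  define D where "D b = E b \<union> E (f b)" for b
  have D_ne: "D b \<noteq> {}" if "b \<in> S\<^sub>1" for b
  proof -
    have "openin U (topspace T)"
      unfolding U_def by (intro openin_clopen_expansion openin_topspace)
    then show ?thesis
      using dense[OF _ ne that fS[OF that]] by (auto simp: D_def)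
  qed
  have D_disj: "D b \<inter> D c = {}" if "b \<in> S\<^sub>1" "c \<in> S\<^sub>1" "b \<noteq> c" for b c
  proof -
    have "f b \<noteq> f c"
      using f that by (auto simp: bij_betw_def inj_on_def)
    moreover have "b \<in> S" "c \<in> S" "f b \<in> S" "f c \<in> S" "b \<noteq> f c" "f b \<noteq> c"
      using that(1,2) fS[OF that(1)] fS[OF that(2)] S(4-6) by blast+
    ultimately have "E b \<inter> E c = {}" "E b \<inter> E (f c) = {}" "E (f b) \<inter> E c = {}" "E (f b) \<inter> E (f c) = {}"
      using that(3) E_disj by simp_all
    then show ?thesis unfolding D_def by blast
  qed
  have inj_D: "inj_on D S\<^sub>1"
    by (rule inj_onI) (metis D_disj D_ne Int_absorb)
  have "D ` S\<^sub>1 \<approx> {..<n}"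
    using inj_D S1 by (simp add: eqpoll_iff_card card_image)
  moreover have "pairwise disjnt (D ` S\<^sub>1)"
    using D_disj by (auto simp: pairwise_def disjnt_def)
  moreover have "D b \<subseteq> topspace U" "U closure_of D b = topspace U" if "b \<in> S\<^sub>1" for b
  proof -
    show "D b \<subseteq> topspace U"
      using E_sub[of b] E_sub[of "f b"] that fS[OF that] S(4,5) unfolding D_def top_U by blast
    show "U closure_of D b = topspace U"
      unfolding dense_intersects_open D_def using dense[OF _ _ that fS[OF that]] by blast
  qed
  ultimately have res: "resolvable {..<n} U"
    unfolding resolvable_def using D_ne by (intro exI[of _ "D ` S\<^sub>1"]) auto

  \<comment> \<open>Absence of \<open>n + 1\<close> disjoint dense sets\<close>
  have "\<not> resolvable {..<n + 1} U"
  proof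
    assume "resolvable {..<n + 1} U"
    then obtain \<G> where \<G>: "\<G> \<approx> {..<n + 1}" "pairwise disjnt \<G>"
      "\<And>H. H \<in> \<G> \<Longrightarrow> U closure_of H = topspace U"
      unfolding resolvable_def by blast
    have fin: "finite \<G>"
      using eqpoll_finite_iff[OF \<G>(1)] by simp
    have card: "card \<G> = n + 1"
      using \<G>(1) eqpoll_iff_card[OF fin finite_lessThan] by simp
    have V0: "basic T \<R> V\<^sub>0"
      using 0(1,6) basic_nonempty[OF B\<^sub>0] by (intro basic_open) auto
    \<comment> \<open>Finitely many applications of \<open>shrink\<close> yield one \<open>C\<close>
      on which every \<open>H\<close> in \<open>\<G>\<close> contains or misses each cell of
      \<open>M\<close>; earlier decisions survive shrinking.\<close>
    have "\<exists>C. basic T \<R> C \<and> C \<subseteq> V\<^sub>0 \<and> (\<forall>(H, b)\<in>Q. C \<inter> E b \<subseteq> H \<or> C \<inter> E b \<inter> H = {})"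
      if "finite Q" "Q \<subseteq> \<G> \<times> S\<^sub>1" for Q
      using that
    proof (induction Q)
      case empty
      then show ?case using V0 by blast
    next
      case (insert q Q)
      obtain H b where q: "q = (H, b)" by fastforce
      obtain C where C: "basic T \<R> C" "C \<subseteq> V\<^sub>0"
        "\<forall>(H, b)\<in>Q. C \<inter> E b \<subseteq> H \<or> C \<inter> E b \<inter> H = {}"
        using insert by auto
      have "b \<in> S" using insert.prems q S by blast
      then obtain C' where "basic T \<R> C'" "C' \<subseteq> C" "C' \<inter> E b \<subseteq> H \<or> C' \<inter> E b \<inter> H = {}"
        using shrink[OF C(1,2), of b H] by blast
      then show ?case
        using C(2,3) unfolding q by (intro exI[of _ C'] conjI ballI) blast+
    qed
    from this[of "\<G> \<times> S\<^sub>1"] obtain C where C: "basic T \<R> C"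
      and decided: "\<And>H b. H \<in> \<G> \<Longrightarrow> b \<in> S\<^sub>1 \<Longrightarrow> C \<inter> E b \<subseteq> H \<or> C \<inter> E b \<inter> H = {}"
      using fin S1(2) by auto
    have C_E: "C \<inter> E b \<noteq> {}" if "b \<in> S\<^sub>1" for b
      using basic_nonempty[OF basic_E[OF C, of b]] that S(4) by blast
    have "openin U (C \<inter> M)"
      unfolding U_def
      by (intro openin_Int openin_basic basic_mono[OF C] openin_clopen_expansion) auto
    moreover have "C \<inter> M \<noteq> {}"
    proof -
      obtain b where "b \<in> S\<^sub>1" using S1(3) assms(1) by fastforce
      then show ?thesis using C_E unfolding M_def by blast
    qed
    ultimately have "H \<inter> (C \<inter> M) \<noteq> {}" if "H \<in> \<G>" for H
      using \<G>(3)[OF that] unfolding dense_intersects_open by blast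
    \<comment> \<open>The dense set \<open>H\<close> meets the open set \<open>C \<inter> M\<close>,
      hence some \<open>C \<inter> E b\<close>, and so must contain it.\<close>
    then have "\<exists>b\<in>S\<^sub>1. C \<inter> E b \<subseteq> H" if "H \<in> \<G>" for H
      using decided[OF that] that unfolding M_def by fast
    then have "\<exists>g. \<forall>H\<in>\<G>. g H \<in> S\<^sub>1 \<and> C \<inter> E (g H) \<subseteq> H"
      by (intro bchoice) blast
    then obtain g where g: "\<And>H. H \<in> \<G> \<Longrightarrow> g H \<in> S\<^sub>1 \<and> C \<inter> E (g H) \<subseteq> H"
      by blast
    \<comment> \<open>Disjoint sets cannot contain the same nonempty \<open>C \<inter> E b\<close>;
      thus \<open>\<G>\<close> has at most as many members as \<open>M\<close> has cells, namely
      \<open>n\<close>.\<close>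
    have "inj_on g \<G>"
    proof (rule inj_onI, rule ccontr)
      fix H H' assume *: "H \<in> \<G>" "H' \<in> \<G>" "g H = g H'" "H \<noteq> H'"
      then have "H \<inter> H' = {}"
        using \<G>(2) by (auto simp: pairwise_def disjnt_def)
      moreover have "C \<inter> E (g H) \<subseteq> H \<inter> H'"
        using g[OF *(1)] g[OF *(2)] *(3) by auto
      ultimately show False
        using C_E g[OF *(1)] by blast
    qed
    then have "card \<G> \<le> card S\<^sub>1"
      using g S1(2) by (intro card_inj_on_le) auto
    then show False using card S1(3) by simp
  qed
  with res MR show ?thesis
    unfolding exactly_resolvable_def U_def by blast
qed

theorem theorem2p4:
  fixes n :: nat and \<T> :: "'a topology"
  assumes "1 < n"
    and "resolvable (UNIV :: nat set) \<T>"
  shows "(\<exists>\<U>. expansion \<U> \<T> \<and> exactly_resolvable n \<U>) \<and>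
         (\<forall>P :: 'a topology \<Rightarrow> bool. CC_sum_property P \<and> P \<T> \<longrightarrow>
            (\<exists>\<U>. expansion \<U> \<T> \<and> exactly_resolvable n \<U> \<and> P \<U>))"
proof -
  \<comment> \<open>One expansion serves every \<open>P\<close>, because it arises only by making
    sets clopen.\<close>
  obtain \<R> where \<R>: "\<R> \<subseteq> Pow (topspace \<T>)" "exactly_resolvable n (clopen_expansion \<T> \<R>)"
    using exactly_resolvable_clopen_expansion[OF assms] by blast
  then show ?thesis
    using expansion_clopen_expansion[OF \<R>(1)] chain_clopen_closed_clopen_expansion[OF _ _ _ \<R>(1)]
    unfolding CC_sum_property_def by blast
qed

end
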